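(* (i) Let $S\equiv\pm\{1, 5, 6, 8, 9, 13, 17, 21, 22, 25, 28, 29\}\pmod{60}$ and $T\equiv\pm\{1, 4, 5, 7, 13, 16, 17, 22, 23, 25, 26, 29\}\pmod{60}$. Then $p(S,n)=p(T,n-1)$ for all $n\geq 1$. (ii) Let $S\equiv\pm\{1, 2, 5, 7, 8, 11, 19, 23, 25, 26, 28, 29\}\pmod{60}$ and $T\equiv\pm\{1, 3, 4, 5, 7, 16, 18, 23, 25, 26, 27, 29\}\pmod{60}$. Then $p(S,n)=p(T,n)$ for all integers $n\ge0$ with $n\neq 2$. (iii) Let $S\equiv\pm\{2, 4, 5, 7, 11, 13, 14, 16, 17, 19, 23, 25\}\pmod{60}$ and $T\equiv\pm\{2, 5, 6, 7, 8, 9, 11, 19, 21, 23, 25, 28\}\pmod{60}$. Then $p(S,n)=p(T,n)$ for all integers $n\ge0$ with $n\neq 4$. (iv) Let $S\equiv\pm\{3, 4, 5, 11, 13, 14, 16, 17, 18, 19, 25, 27\}\pmod{60}$ and $T\equiv\pm\{1, 5, 8, 11, 13, 14, 17, 19, 22, 25, 28, 29\}\pmod{60}$. Then $p(S,n)=p(T,n-3)$ for all $n\geq 3$.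
   Context: For a set $S$ of positive integers and an integer $n\ge 0$, $p(S,n)$ denotes the number of partitions of $n$ into parts belonging to $S$ (so $p(S,0)=1$). The notation $S\equiv\pm\{r_1,\dots,r_k\}\pmod M$ means that $S$ is the set of all positive integers $n$ such that $n\equiv r_i$ or $n\equiv -r_i\pmod M$ for some $i$. *)

theory Defs
  imports Complex_Main "HOL-Library.Multiset" "HOL-Number_Theory.Cong"
begin

text \<open>A partition is the multiset of its parts.\<close>

definition partitions_into :: "nat set \<Rightarrow> nat \<Rightarrow> nat multiset set" where
  "partitions_into S n = {P. set_mset P \<subseteq> S \<and> sum_mset P = n}"

definition num_partitions :: "nat set \<Rightarrow> nat \<Rightarrow> nat" where
  "num_partitions S n = card (partitions_into S n)"

definition pm_residues :: "int set \<Rightarrow> int \<Rightarrow> nat set" where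
  "pm_residues R M = {n. 0 < n \<and> (\<exists>r\<in>R. [int n = r] (mod M) \<or> [int n = - r] (mod M))}"

text \<open>The cardinality above is that of a finite set as soon as all parts are positive.\<close>

lemma finite_partitions_into:
  assumes "0 \<notin> S"
  shows "finite (partitions_into S n)"
proof -
  have "partitions_into S n \<subseteq> mset ` {xs. set xs \<subseteq> {..n} \<and> length xs \<le> n}"
  proof
    fix P assume P: "P \<in> partitions_into S n"
    obtain xs where xs: "P = mset xs" by (metis ex_mset)
    have sum: "sum_list xs = n" and "set xs \<subseteq> S"
      using P by (auto simp: partitions_into_def xs sum_mset_sum_list)
    hence "0 \<notin> set xs" using assms by auto
    hence "length xs \<le> sum_list xs" by (induction xs) auto
    moreover have "set xs \<subseteq> {..n}"
      using sum member_le_sum_list by auto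
    ultimately show "P \<in> mset ` {xs. set xs \<subseteq> {..n} \<and> length xs \<le> n}"
      using sum xs by auto
  qed
  thus ?thesis
    by (rule finite_subset) (intro finite_imageI finite_lists_length_le finite_atMost)
qed

lemma zero_notin_pm_residues: "0 \<notin> pm_residues R M"
  by (simp add: pm_residues_def)

lemma num_partitions_0:
  assumes "0 \<notin> S"
  shows "num_partitions S 0 = 1"
proof -
  have "P = {#}" if "P \<in> partitions_into S 0" for P
  proof (rule ccontr)
    assume "P \<noteq> {#}"
    then obtain x where "x \<in># P" by auto
    moreover from this have "x = 0"
      using that by (auto simp: partitions_into_def)
    ultimately show False using that assms by (auto simp: partitions_into_def)
  qed
  moreover have "{#} \<in> partitions_into S 0" by (simp add: partitions_into_def)
  ultimately have "partitions_into S 0 = {{#}}" by blast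
  thus ?thesis by (simp add: num_partitions_def)
qed

end

theory Submission
  imports Defs "HOL-Analysis.Analysis" "HOL-Library.Nat_Bijection"
begin

text \<open>
  Let \<open>\<theta>(z) = (z; Q) (Q/z; Q)\<close> with infinite \<open>Q\<close>-Pochhammer symbols
  and \<open>W(x, y) = \<theta>(xy) \<theta>(x/y)\<close>. Weierstrass's three-term relation says
  that \<open>b W(a,b) W(c,d) + c W(a,d) W(b,c) = c W(a,c) W(b,d)\<close>. With \<open>Q =
  q^30\<close> every \<open>\<theta>(\<plusminus>q^r)\<close> is a quotient of products \<open>(q^s;
  q^60) (q^(60-s); q^60)\<close>. For \<open>a, b, c, d = -q^9, q^5, -q^4, q^3\<close>, dividing the
  relation by its last term leaves exactly \<open>1/\<Prod>\<^sub>S - q/\<Prod>\<^sub>T = 1\<close>,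
  where \<open>\<Prod>\<^sub>S\<close> and \<open>\<Prod>\<^sub>T\<close> are the products of
  \<open>1 - q^s\<close> over \<open>s\<close> in \<open>S\<close> and \<open>T\<close>; this is
  part (i) for generating functions, and the other parts arise from conjugate parameters.

  The three-term relation itself follows from the Jacobi triple product, which is the limit of a
  finite version proved by the two Pascal rules for \<open>q\<close>-binomials.
\<close>

subsection \<open>Infinite products\<close>

definition qpoch :: "real \<Rightarrow> real \<Rightarrow> real" where
  "qpoch a q = (\<Prod>n. 1 - a * q ^ n)"

lemma convergent_prod_qpoch:
  assumes "\<bar>q\<bar> < 1"
  shows "convergent_prod (\<lambda>n. 1 - a * q ^ n :: real)"
proof (rule abs_convergent_prod_imp_convergent_prod, rule summable_imp_abs_convergent_prod)
  have "summable (\<lambda>n. \<bar>a\<bar> * \<bar>q\<bar> ^ n)"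
    using assms by (intro summable_mult summable_geometric) auto
  thus "summable (\<lambda>n. norm (1 - a * q ^ n - 1))"
    by (simp add: abs_mult power_abs)
qed

lemma qpoch_LIMSEQ:
  assumes "\<bar>q\<bar> < 1"
  shows "(\<lambda>n. \<Prod>i<n. 1 - a * q ^ i) \<longlonglongrightarrow> qpoch a q"
  using has_prod_imp_tendsto'[OF convergent_prod_has_prod[OF convergent_prod_qpoch[OF assms]]]
  by (simp add: qpoch_def)

lemma qpoch_nonzero:
  assumes "\<bar>q\<bar> < 1" "\<bar>a\<bar> < 1"
  shows "qpoch a q \<noteq> 0"
proof -
  have "a * q ^ n \<noteq> 1" for n
  proof -
    have "\<bar>a * q ^ n\<bar> \<le> \<bar>a\<bar> * 1"
      unfolding abs_mult power_abs using assms by (intro mult_left_mono power_le_one) auto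
    thus ?thesis using assms by auto
  qed
  thus ?thesis unfolding qpoch_def
    by (intro prodinf_nonzero convergent_prod_qpoch assms) (metis eq_iff_diff_eq_0)
qed

text \<open>Factors of even and of odd index are collected separately, so one product in base
  \<open>q\<close> becomes two in base \<open>q\<^sup>2\<close>; this is how level 30 passes to
  level 60.\<close>

lemma qpoch_bisect:
  assumes "\<bar>q\<bar> < 1"
  shows "qpoch a q = qpoch a (q\<^sup>2) * qpoch (a * q) (q\<^sup>2)"
proof -
  have q2: "\<bar>q\<^sup>2\<bar> < 1" using assms by (simp add: abs_square_less_1)
  have "(\<Prod>i<2*n. 1 - a * q ^ i)
      = (\<Prod>i<n. 1 - a * (q\<^sup>2) ^ i) * (\<Prod>i<n. 1 - a * q * (q\<^sup>2) ^ i)" for n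
    by (induction n) (simp_all add: power_mult[symmetric] algebra_simps)
  moreover have "(\<lambda>n. \<Prod>i<2*n. 1 - a * q ^ i) \<longlonglongrightarrow> qpoch a q"
    by (rule LIMSEQ_subseq_LIMSEQ[OF qpoch_LIMSEQ[OF assms], of "\<lambda>n. 2 * n", unfolded o_def])
       (simp add: strict_mono_def)
  moreover have "(\<lambda>n. (\<Prod>i<n. 1 - a * (q\<^sup>2) ^ i) * (\<Prod>i<n. 1 - a * q *
      (q\<^sup>2) ^ i))
      \<longlonglongrightarrow> qpoch a (q\<^sup>2) * qpoch (a * q) (q\<^sup>2)"
    by (intro tendsto_mult qpoch_LIMSEQ q2)
  ultimately show ?thesis using LIMSEQ_unique by simp
qed

lemma qpoch_mult_minus:
  assumes "\<bar>q\<bar> < 1"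
  shows "qpoch (-a) q * qpoch a q = qpoch (a\<^sup>2) (q\<^sup>2)"
proof -
  have q2: "\<bar>q\<^sup>2\<bar> < 1" using assms by (simp add: abs_square_less_1)
  have "(1 - (-a) * q ^ i) * (1 - a * q ^ i) = 1 - a\<^sup>2 * (q\<^sup>2) ^ i" for i
    by (simp add: algebra_simps power2_eq_square power_mult_distrib)
  hence "(\<Prod>i<n. 1 - (-a) * q ^ i) * (\<Prod>i<n. 1 - a * q ^ i)
      = (\<Prod>i<n. 1 - a\<^sup>2 * (q\<^sup>2) ^ i)" for n
    by (simp add: prod.distrib[symmetric])
  moreover have "(\<lambda>n. (\<Prod>i<n. 1 - (-a) * q ^ i) * (\<Prod>i<n. 1 - a * q ^ i))
      \<longlonglongrightarrow> qpoch (-a) q * qpoch a q"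
    by (intro tendsto_mult qpoch_LIMSEQ assms)
  ultimately show ?thesis using LIMSEQ_unique[OF _ qpoch_LIMSEQ[OF q2]] by simp
qed

subsection \<open>The Jacobi triple product\<close>

text \<open>The finite Pochhammer symbol (q; q)_n. The usual q-factorial divides every factor by
  \<open>1 - q\<close>; those powers cancel in \<open>qbinom\<close>.\<close>

definition qfact :: "real \<Rightarrow> nat \<Rightarrow> real" where
  "qfact q n = (\<Prod>i<n. 1 - q * q ^ i)"

text \<open>The lower index is an integer and the value off the range is 0, so that the Pascal rules
  hold for every \<open>k\<close> and sums may run over all integers without boundary terms.\<close>

definition qbinom :: "real \<Rightarrow> nat \<Rightarrow> int \<Rightarrow> real" where
  "qbinom q N k = (if 0 \<le> k \<and> k \<le> int N
     then qfact q N / (qfact q (nat k) * qfact q (nat (int N - k))) else 0)"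

lemma qfact_0 [simp]: "qfact q 0 = 1"
  and qfact_Suc [simp]: "qfact q (Suc n) = qfact q n * (1 - q * q ^ n)"
  by (simp_all add: qfact_def)

lemma qfact_pos:
  assumes "0 < q" "q < 1"
  shows "qfact q n > 0"
  using assms by (induction n) (auto intro!: mult_pos_pos simp flip: power_Suc simp: power_Suc_less_one)

lemma qbinom_sym: "qbinom q N (int N - k) = qbinom q N k"
  by (simp add: qbinom_def mult.commute)

lemma qbinom_pascal:
  assumes q: "0 < q" "q < 1"
  shows "qbinom q (Suc N) k = qbinom q N (k - 1) + q powi k * qbinom q N k"
proof -
  note pos = qfact_pos[OF q]
  have nat_Suc: "nat (1 + int N) = Suc N" "nat (int N + 1) = Suc N" by auto
  consider "k < 0" | "k = 0" | "k = int N + 1" | "k > int N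
      + 1" | "1 \<le> k" "k \<le> int N" by linarith
  thus ?thesis
  proof cases
    case 5
    \<comment> \<open>Put \<open>k = i + 1\<close> and \<open>N - k = j\<close>, so that every
      natural difference below becomes \<open>i\<close>, \<open>j\<close> or a successor.\<close>
    define i where "i = nat (k - 1)"
    define j where "j = N - i - 1"
    have k: "k = int (Suc i)" and N: "N = i + j + 1" using 5 by (auto simp: i_def j_def)
    have ne: "1 - q * q ^ n \<noteq> 0" for n
      using q power_Suc_less_one[of q n] by simp
    have d: "nat (int N - k) = j" "nat (int (Suc N) - k) = Suc j" "nat k = Suc i" "nat (k - 1) = i"
      "nat (int N - (k - 1)) = Suc j"
      using k N by auto
    have ne': "qfact q n \<noteq> 0" for n using pos[of n] by simp
    have pk: "q powi k = q * q ^ i" unfolding k power_int_of_nat by simp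
    have "qbinom q N (k - 1) + q powi k * qbinom q N k =
        qfact q N / (qfact q i * qfact q (Suc j))
            + q * q ^ i * (qfact q N / (qfact q (Suc i) * qfact q j))"
      using 5 by (simp add: qbinom_def d pk del: qfact_Suc)
    also have "\<dots> = qfact q N * ((1 - q * q ^ i)
        + q * q ^ i * (1 - q * q ^ j)) / (qfact q (Suc i) * qfact q (Suc j))"
      using ne ne' by (simp add: divide_simps) (simp add: algebra_simps)
    \<comment> \<open>The numerator telescopes to the last factor of
      \<open>qfact q (Suc N)\<close>.\<close>
    also have "(1 - q * q ^ i) + q * q ^ i * (1 - q * q ^ j) = 1 - q * q ^ N"
      by (simp add: N algebra_simps power_add)
    also have "qfact q N * \<dots> / (qfact q (Suc i) * qfact q (Suc j)) = qbinom q (Suc N) k"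
      using 5 unfolding qbinom_def d by simp
    finally show ?thesis ..
  qed (use pos[of N] pos[of "Suc N"] in \<open>auto simp: qbinom_def nat_Suc simp del: qfact_Suc\<close>)
qed

text \<open>The first Pascal rule reflected by \<open>qbinom_sym\<close>. Each of the two rules
  drives one of the inductions for the finite triple product.\<close>

lemma qbinom_pascal':
  assumes q: "0 < q" "q < 1"
  shows "qbinom q (Suc N) k = qbinom q N k + q powi (int N + 1 - k) * qbinom q N (k - 1)"
proof -
  have "qbinom q (Suc N) k = qbinom q (Suc N) (int N + 1 - k)"
    using qbinom_sym[of q "Suc N" k] by (simp add: add.commute)
  also have "\<dots> = qbinom q N (int N - k) + q powi (int N + 1 - k) * qbinom q N (int N - (k - 1))"
    using qbinom_pascal[OF q, of N "int N + 1 - k"] by (simp add: algebra_simps)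
  finally show ?thesis by (simp only: qbinom_sym)
qed

text \<open>
  The nome is \<open>p\<^sup>2\<close> and the argument of the theta function is \<open>- w\<close>,
  which avoids halves in the exponents and alternating signs.
\<close>

definition theta_term :: "real \<Rightarrow> real \<Rightarrow> int \<Rightarrow> real" where
  "theta_term p w k = p powi (k * (k - 1)) * w powi k"

lemma theta_term_shift:
  assumes "p > 0" "w \<noteq> 0"
  shows "theta_term p w (k + 1) = p powi (2 * k) * w * theta_term p w k"
proof -
  have "p powi ((k + 1) * k) = p powi (2 * k) * p powi (k * (k - 1))"
    using assms by (subst power_int_add[symmetric]) (auto simp: algebra_simps)
  thus ?thesis using assms by (simp add: theta_term_def power_int_add algebra_simps)
qed

lemma has_sum_shift_int:
  "((\<lambda>k::int. f (k + c)) has_sum s) UNIV \<longleftrightarrow> (f has_sum s) UNIV"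
  by (rule has_sum_reindex_bij_witness[of _ "\<lambda>k. k - c" "\<lambda>k. k + c"]) auto

text \<open>Cauchy's finite form of the triple product. With \<open>q = p\<^sup>2\<close>, raising
  \<open>m\<close> multiplies the product by \<open>1 + w * q ^ m\<close> and raising
  \<open>n\<close> multiplies it by \<open>1 + q ^ (n + 1) / w\<close>. The extra term is the old
  series shifted by one index, and a Pascal rule merges the two series.\<close>

lemma finite_triple_product:
  assumes p: "0 < p" "p < 1" and w: "w \<noteq> 0"
  shows "((\<lambda>k. qbinom (p\<^sup>2) (m + n) (int n + k) * theta_term p w k) has_sum
          ((\<Prod>i<m. 1 - (-w) * (p\<^sup>2) ^ i) * (\<Prod>i<n. 1 - (-(p\<^sup>2) / w) *
              (p\<^sup>2) ^ i))) UNIV"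
proof -
  define q where "q = p\<^sup>2"
  have q: "0 < q" "q < 1" using p by (auto simp: q_def power_less_one_iff)
  have qpow: "p powi (2 * k) = q powi k" for k by (simp add: q_def power_int_mult)
  define T where "T = theta_term p w"
  have T: "T (k + 1) = q powi k * w * T k" for k
    unfolding T_def using theta_term_shift[of p w k] p w by (simp add: qpow)
  show ?thesis unfolding q_def[symmetric] T_def[symmetric]
  proof (induction n)
    case 0
    show ?case
    proof (induction m)
      case 0
      have "((\<lambda>k. qbinom q 0 k * T k) has_sum (qbinom q 0 0 * T 0)) UNIV"
        by (rule has_sum_finite_neutralI[of "{0}"]) (auto simp: qbinom_def)
      thus ?case by (simp add: qbinom_def T_def theta_term_def)
    next
      case (Suc m)
      let ?P = "\<Prod>i<m. 1 - (-w) * q ^ i"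
      have S: "((\<lambda>k. qbinom q m k * T k) has_sum ?P) UNIV" using Suc by simp
      hence "((\<lambda>k. qbinom q m (k - 1) * T (k - 1)) has_sum ?P) UNIV"
        using has_sum_shift_int[of "\<lambda>k. qbinom q m k * T k" "-1"] by simp
      hence "((\<lambda>k. qbinom q m k * T k + w * q ^ m * (qbinom q m (k - 1) * T (k - 1)))
               has_sum (?P + w * q ^ m * ?P)) UNIV"
        by (intro has_sum_add S has_sum_cmult_right)
      moreover have "qbinom q m k * T k + w * q ^ m * (qbinom q m (k - 1) * T (k - 1))
          = qbinom q (Suc m) k * T k" for k
      proof -
        \<comment> \<open>\<open>T k\<close> supplies \<open>q powi (k - 1)\<close>, which removes
          \<open>k\<close> from the Pascal factor, so that it can be taken out of the
          series.\<close>
        have "q powi (int m + 1 - k) * q powi (k - 1) = q ^ m"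
          using q by (subst power_int_add[symmetric]) (auto)
        hence "q powi (int m + 1 - k) * T k = w * q ^ m * T (k - 1)"
          using T[of "k - 1"] by simp
        thus ?thesis unfolding qbinom_pascal'[OF q, of m k] by (simp add: algebra_simps)
      qed
      ultimately show ?case by (simp add: algebra_simps)
    qed
  next
    case (Suc n)
    let ?P = "(\<Prod>i<m. 1 - (-w) * q ^ i) * (\<Prod>i<n. 1 - (-q / w) * q ^ i)"
    have S: "((\<lambda>k. qbinom q (m + n) (int n + k) * T k) has_sum ?P) UNIV" by (rule Suc)
    hence "((\<lambda>k. qbinom q (m + n) (int n + (k + 1)) * T (k + 1)) has_sum ?P) UNIV"
      using has_sum_shift_int[of "\<lambda>k. qbinom q (m + n) (int n + k) * T k" 1] by simp
    hence "((\<lambda>k. qbinom q (m + n) (int n + k) * T k + q / w * q ^ n * (qbinom q (m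
        + n) (int n + (k + 1)) * T (k + 1)))
               has_sum (?P + q / w * q ^ n * ?P)) UNIV"
      by (intro has_sum_add S has_sum_cmult_right)
    moreover have "qbinom q (m + n) (int n + k) * T k + q / w * q ^ n * (qbinom q (m + n) (int n
        + (k + 1)) * T (k + 1))
          = qbinom q (m + Suc n) (int (Suc n) + k) * T k" for k
    proof -
      have "q powi (int (Suc n) + k) = q * q ^ n * q powi k"
        using q power_int_of_nat[of q "Suc n"] by (subst power_int_add) (auto simp del: power_int_of_nat)
      hence e1: "q powi (int (Suc n) + k) * T k = q / w * q ^ n * T (k + 1)"
        using T[of k] w by simp
      have e2: "int (Suc n) + k - 1 = int n + k" and e3: "int n + (k + 1) = int (Suc n) + k" by simp_all
      have "qbinom q (m + Suc n) (int (Suc n) + k) * T k = qbinom q (m + n) (int n + k) * T k +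
          qbinom q (m + n) (int (Suc n) + k) * (q powi (int (Suc n) + k) * T k)"
        unfolding add_Suc_right qbinom_pascal[OF q, of "m + n" "int (Suc n) + k"] e2
        by (simp only: distrib_left distrib_right mult_ac)
      thus ?thesis unfolding e1 e3 by (simp only: mult_ac)
    qed
    ultimately show ?case by (simp add: algebra_simps)
  qed
qed

section \<open>Passage from the finite to the infinite triple product\<close>

lemma summable_theta_nat:
  assumes p: "0 < p" "p < 1" and w: "(w::real) > 0"
  shows "summable (\<lambda>n::nat. p ^ (n * (n - 1)) * w ^ n)"
proof -
  \<comment> \<open>This is the ratio of consecutive terms; it tends to 0 and so eventually stays
    below the bound 1/2 of the ratio test.\<close>
  have "(\<lambda>n. (p\<^sup>2) ^ n * w) \<longlonglongrightarrow> 0 * w"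
    using p by (intro tendsto_mult tendsto_const LIMSEQ_power_zero) (auto simp: power_less_one_iff)
  hence "eventually (\<lambda>n. (p\<^sup>2) ^ n * w < 1/2) sequentially"
    by (rule order_tendstoD) auto
  then obtain N where N: "\<And>n. n \<ge> N \<Longrightarrow> (p\<^sup>2) ^ n * w < 1/2"
    by (auto simp: eventually_sequentially)
  show ?thesis
  proof (rule summable_ratio_test[of "1/2" N])
    fix n assume n: "n \<ge> N"
    have e: "Suc n * (Suc n - 1) = n * (n - 1) + 2 * n"
      by (cases n) (auto simp: algebra_simps)
    have "p ^ (Suc n * (Suc n - 1)) * w ^ Suc n = (p ^ (n * (n - 1)) * w ^ n) * ((p\<^sup>2) ^ n * w)"
      unfolding e power_add power_mult by simp
    also have "\<dots> \<le> (p ^ (n * (n - 1)) * w ^ n) * (1/2)"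
      using N[OF n] p w by (intro mult_left_mono) auto
    finally show "norm (p ^ (Suc n * (Suc n - 1)) * w ^ Suc n) \<le> 1/2 * norm (p ^ (n * (n - 1)) * w
        ^ n)"
      using p w by (simp add: abs_mult)
  qed auto
qed

text \<open>Each half of the integers gives a series as in \<open>summable_theta_nat\<close>:
  substituting \<open>k = - n\<close> replaces \<open>\<bar>w\<bar>\<close> by
  \<open>p\<^sup>2 / \<bar>w\<bar>\<close>.\<close>

lemma theta_term_abs_summable:
  assumes p: "0 < p" "p < 1" and w: "w \<noteq> 0"
  shows "(\<lambda>k. norm (theta_term p w k)) summable_on UNIV"
proof -
  define f where "f k = norm (theta_term p w k)" for k
  have f: "f k = p powi (k * (k - 1)) * \<bar>w\<bar> powi k" for k
    using p by (simp add: f_def theta_term_def abs_mult power_int_abs)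
  have "f (int n) = p ^ (n * (n - 1)) * \<bar>w\<bar> ^ n" for n
  proof -
    have "int n * (int n - 1) = int (n * (n - 1))" by (cases n) (auto simp: algebra_simps)
    thus ?thesis unfolding f by (simp only: power_int_of_nat)
  qed
  hence "(\<lambda>n. f (int n)) summable_on UNIV"
    using summable_theta_nat[OF p, of "\<bar>w\<bar>"] w p
        by (subst summable_on_UNIV_nonneg_real_iff) auto
  hence 1: "f summable_on range int"
    by (subst summable_on_reindex) (auto simp: o_def)
  have "f (- int n) = p ^ (n * (n - 1)) * (p\<^sup>2 / \<bar>w\<bar>) ^ n" for n
  proof -
    have "(- int n) * (- int n - 1) = int (n * (n - 1) + 2 * n)"
      by (cases n) (auto simp: algebra_simps)
    hence "f (- int n) = p ^ (n * (n - 1) + 2 * n) * \<bar>w\<bar> powi (- int n)"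
      unfolding f by (simp only: power_int_of_nat)
    thus ?thesis using w
      by (simp add: power_add power_mult[of p 2 n] power_int_minus power_divide divide_inverse
          power_mult_distrib power_inverse)
  qed
  hence "(\<lambda>n. f (- int n)) summable_on UNIV"
    using summable_theta_nat[OF p, of "p\<^sup>2 / \<bar>w\<bar>"] w p
    by (subst summable_on_UNIV_nonneg_real_iff) auto
  hence 2: "f summable_on range (\<lambda>n. - int n)"
    by (subst summable_on_reindex) (auto simp: o_def inj_def)
  have "(UNIV :: int set) = range int \<union> range (\<lambda>n. - int n)"
  proof -
    have "k \<in> range int \<union> range (\<lambda>n. - int n)" for k :: int
      by (cases k rule: int_cases2) auto
    thus ?thesis by blast
  qed
  moreover have "f summable_on range int \<union> range (\<lambda>n. - int n)"
    using 1 2 by (rule summable_on_union)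
  ultimately show ?thesis by (simp add: f_def[abs_def])
qed

text \<open>Dominated convergence for series over the integers: Tannery's theorem, carried over from
  the naturals by the bijection \<open>int_decode\<close>.\<close>

lemma has_sum_dominated:
  fixes a :: "nat \<Rightarrow> int \<Rightarrow> real"
  assumes lim: "\<And>k. (\<lambda>n. a n k) \<longlonglongrightarrow> b k"
    and bound: "\<And>n k. \<bar>a n k\<bar> \<le> M k" and M: "M summable_on UNIV"
    and sums: "\<And>n. (a n has_sum s n) UNIV" and s: "s \<longlonglongrightarrow> L"
  shows "(b has_sum L) UNIV"
proof -
  have M_nn: "M k \<ge> 0" for k using bound[of 0 k] by linarith
  have bij: "bij_betw int_decode UNIV UNIV" by (rule bij_int_decode)
  have "(\<lambda>n. M (int_decode n)) summable_on UNIV"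
    using M by (subst summable_on_reindex_bij_betw[OF bij])
  hence M': "summable (\<lambda>n. M (int_decode n))"
    using M_nn by (subst (asm) summable_on_UNIV_nonneg_real_iff) auto
  have sum_a: "s n = (\<Sum>j. a n (int_decode j))" for n
  proof -
    have "((\<lambda>j. a n (int_decode j)) has_sum s n) UNIV"
      using sums[of n] by (subst has_sum_reindex_bij_betw[OF bij])
    thus ?thesis by (auto dest: has_sum_imp_sums sums_unique)
  qed
  have T: "summable (\<lambda>j. norm (b (int_decode j))) \<and>
        (\<lambda>n. \<Sum>j. a n (int_decode j)) \<longlonglongrightarrow> (\<Sum>j. b (int_decode j))"
    using tannerys_theorem[of "\<lambda>j n. a n (int_decode j)" "\<lambda>j. b (int_decode j)"
        sequentially
        "\<lambda>j. M (int_decode j)"] lim M' bound by (auto intro!: always_eventually)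
  hence "(\<Sum>j. b (int_decode j)) = L" using s LIMSEQ_unique unfolding sum_a by blast
  with T have "((\<lambda>j. b (int_decode j)) has_sum L) UNIV"
    using norm_summable_imp_has_sum[of "\<lambda>j. b (int_decode j)" L]
    by (metis summable_sums summable_norm_cancel)
  thus ?thesis by (subst (asm) has_sum_reindex_bij_betw[OF bij])
qed

text \<open>Set \<open>m = n\<close> in the finite identity and let \<open>n\<close> grow. With
  \<open>q = p\<^sup>2\<close> and \<open>E\<close> the limit of \<open>qfact q\<close>, the
  coefficient \<open>qbinom q (n + n) (int n + k)\<close> tends to \<open>1 / E\<close> for fixed
  \<open>k\<close>, and all coefficients are at most \<open>1 / (E * E)\<close>, so a multiple of
  the theta series dominates.\<close>

lemma triple_product:
  assumes p: "0 < p" "p < 1" and w: "w \<noteq> 0"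
  shows "(theta_term p w has_sum
          (qpoch (p\<^sup>2) (p\<^sup>2) * qpoch (-w) (p\<^sup>2) * qpoch (-(p\<^sup>2) / w)
              (p\<^sup>2))) UNIV"
proof -
  define q where "q = p\<^sup>2"
  have q: "0 < q" "q < 1" "\<bar>q\<bar> < 1" using p by (auto simp: q_def power_less_one_iff)
  note pos = qfact_pos[OF q(1,2)]
  define E where "E = qpoch q q"
  have fact_lim: "qfact q \<longlonglongrightarrow> E"
    using qpoch_LIMSEQ[OF q(3), of q] by (simp add: E_def qfact_def[abs_def])
  have dec: "qfact q (Suc n) \<le> qfact q n" for n
    using pos[of n] q by (simp add: mult_le_cancel_left1)
  have decseq: "decseq (qfact q)" using dec by (rule decseq_SucI)
  have E_le: "E \<le> qfact q n" for n
    by (rule decseq_ge[OF decseq fact_lim])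
  have le1: "qfact q n \<le> 1" for n
    using decseqD[OF decseq, of 0 n] by simp
  have "E \<noteq> 0" unfolding E_def using q by (intro qpoch_nonzero) auto
  moreover have "E \<ge> 0"
      by (rule LIMSEQ_le_const[OF fact_lim]) (use pos in \<open>auto intro!: exI[of _ 0]
      less_imp_le\<close>)
  ultimately have E: "E > 0" by simp
  have qb_bound: "\<bar>qbinom q N k\<bar> \<le> 1 / (E * E)" for N k
  proof (cases "0 \<le> k \<and> k \<le> int N")
    case True
    \<comment> \<open>The numerator is at most 1 and, since \<open>qfact q\<close> decreases to
      \<open>E\<close>, both factors of the denominator are at least \<open>E\<close>.\<close>
    have "qfact q N / (qfact q (nat k) * qfact q (nat (int N - k))) \<le> 1 / (E * E)"
      using E by (intro frac_le mult_mono E_le le1 mult_pos_pos) (auto intro: less_imp_le pos)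
    moreover have "qbinom q N k \<ge> 0"
      using True by (auto simp: qbinom_def intro!: divide_nonneg_nonneg mult_nonneg_nonneg
          less_imp_le[OF pos])
    ultimately show ?thesis using True by (simp add: qbinom_def)
  qed (use E in \<open>auto simp: qbinom_def\<close>)
  have qb_lim: "(\<lambda>n. qbinom q (n + n) (int n + k)) \<longlonglongrightarrow> 1 / E" for k
  proof -
    have shift: "filterlim (\<lambda>n. nat (int n + c)) at_top sequentially" for c :: int
      unfolding filterlim_at_top
    proof
      fix Z :: nat
      show "\<forall>\<^sub>F n in sequentially. Z \<le> nat (int n + c)"
        using eventually_ge_at_top[of "Z + nat \<bar>c\<bar>"] by eventually_elim linarith
    qed
    have "(\<lambda>n. qfact q (n + n) / (qfact q (nat (int n + k)) * qfact q (nat (int n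
        + - k)))) \<longlonglongrightarrow> E / (E * E)"
      using E by (intro tendsto_divide tendsto_mult filterlim_compose[OF fact_lim] shift
          filterlim_subseq) (auto simp: strict_mono_def)
    also have "E / (E * E) = 1 / E" using E by simp
    finally show ?thesis
    proof (rule Lim_transform_eventually)
      show "\<forall>\<^sub>F n in sequentially. qfact q (n + n) / (qfact q (nat (int n
          + k)) * qfact q (nat (int n + - k)))
          = qbinom q (n + n) (int n + k)"
        using eventually_ge_at_top[of "nat \<bar>k\<bar>"]
      proof eventually_elim
        case (elim n)
        have "0 \<le> int n + k \<and> int n + k \<le> int (n + n)" using elim by linarith
        thus ?case by (simp add: qbinom_def)
      qed
    qed
  qed
  have "((\<lambda>k. 1 / E * theta_term p w k) has_sum (qpoch (-w) q * qpoch (-q / w) q)) UNIV"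
  proof (rule has_sum_dominated)
    show "(\<lambda>n. qbinom q (n + n) (int n + k) * theta_term p w k)
        \<longlonglongrightarrow> 1 / E * theta_term p w k" for k
      by (intro tendsto_mult qb_lim tendsto_const)
    show "\<bar>qbinom q (n + n) (int n
        + k) * theta_term p w k\<bar> \<le> 1 / (E * E) * norm (theta_term p w k)" for n k
      unfolding abs_mult real_norm_def by (intro mult_right_mono qb_bound) auto
    show "(\<lambda>k. 1 / (E * E) * norm (theta_term p w k)) summable_on UNIV"
      by (intro summable_on_cmult_right theta_term_abs_summable p w)
    show "((\<lambda>k. qbinom q (n + n) (int n + k) * theta_term p w k) has_sum
          ((\<Prod>i<n. 1 - (-w) * q ^ i) * (\<Prod>i<n. 1 - (-q / w) * q ^ i))) UNIV" for n
      unfolding q_def by (rule finite_triple_product[OF p w])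
    show "(\<lambda>n. (\<Prod>i<n. 1 - (-w) * q ^ i) * (\<Prod>i<n. 1 - (-q / w) * q ^ i))
        \<longlonglongrightarrow> qpoch (-w) q * qpoch (-q / w) q"
      by (intro tendsto_mult qpoch_LIMSEQ q)
  qed
  hence "((\<lambda>k. E * (1 / E * theta_term p w k))
      has_sum (E * (qpoch (-w) q * qpoch (-q / w) q))) UNIV"
    by (rule has_sum_cmult_right)
  thus ?thesis using E by (simp add: q_def E_def mult.assoc)
qed

subsection \<open>The three-term relation\<close>

definition theta :: "real \<Rightarrow> real \<Rightarrow> real" where
  "theta z q = qpoch z q * qpoch (q / z) q"

text \<open>\<open>theta0\<close> and \<open>theta1\<close> are the even and odd halves of the
  series with terms \<open>p powr (j\<^sup>2 / 2) * x powi j\<close>, except that a factor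
  \<open>sqrt p\<close> is dropped from the odd half to keep its exponents integral.\<close>

definition theta0 :: "real \<Rightarrow> real \<Rightarrow> real" where
  "theta0 p x = (\<Sum>\<^sub>\<infinity>k::int. p powi (2 * k\<^sup>2) * x powi (2 * k))"

definition theta1 :: "real \<Rightarrow> real \<Rightarrow> real" where
  "theta1 p x = (\<Sum>\<^sub>\<infinity>k::int. p powi (2 * k\<^sup>2 + 2 * k) * x powi (2 * k + 1))"

text \<open>The terms are theta terms with \<open>p\<^sup>2\<close> in place of \<open>p\<close> and
  argument \<open>p\<^sup>2 * x\<^sup>2\<close>.\<close>

lemma theta_series0:
  fixes p x :: real
  assumes p: "0 < p" "p < 1" and x: "x \<noteq> 0"
  shows "(\<lambda>k::int. norm (p powi (2 * k\<^sup>2) * x powi (2 * k))) summable_on UNIV"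
proof -
  have "theta_term (p\<^sup>2) (p\<^sup>2 * x\<^sup>2) k = p powi (2 * k\<^sup>2) * x powi (2 * k)" for k
  proof -
    have sq: "(z\<^sup>2) powi j = z powi (2 * j)" for z :: real and j
      by (simp add: power_int_mult)
    have "theta_term (p\<^sup>2) (p\<^sup>2 * x\<^sup>2) k = p powi (2 * (k * (k - 1))
        + 2 * k) * x powi (2 * k)"
      using p x by (simp only: theta_term_def power_int_mult_distrib sq) (simp add: power_int_add)
    also have "2 * (k * (k - 1)) + 2 * k = 2 * k\<^sup>2" by (simp add: algebra_simps power2_eq_square)
    finally show ?thesis .
  qed
  thus ?thesis
    using theta_term_abs_summable[of "p\<^sup>2" "p\<^sup>2 * x\<^sup>2"] p x
        by (simp add: power_less_one_iff)
qed

text \<open>Reduces to \<open>theta_series0\<close> at \<open>p * x\<close>, which contributes the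
  linear part \<open>2 * k\<close> of the exponent of \<open>p\<close>.\<close>

lemma theta_series1:
  fixes p x :: real
  assumes p: "0 < p" "p < 1" and x: "x \<noteq> 0"
  shows "(\<lambda>k::int. norm (p powi (2 * k\<^sup>2 + 2 * k) * x powi (2 * k + 1))) summable_on UNIV"
proof -
  have "x * (p powi (2 * k\<^sup>2) * (p * x) powi (2 * k)) = p powi (2 * k\<^sup>2
      + 2 * k) * x powi (2 * k + 1)" for k
    using p x by (simp add: power_int_mult_distrib power_int_add mult_ac)
  hence "norm x * norm (p powi (2 * k\<^sup>2) * (p * x) powi (2 * k)) = norm (p powi (2 * k\<^sup>2
      + 2 * k) * x powi (2 * k + 1))" for k
    by (metis norm_mult)
  thus ?thesis
    using summable_on_cmult_right[OF theta_series0[of p "p * x"], of "norm x"] p x by simp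
qed

lemma has_sum_product:
  fixes f :: "'a \<Rightarrow> real" and g :: "'b \<Rightarrow> real"
  assumes f: "(\<lambda>x. norm (f x)) summable_on A" and g: "(\<lambda>x. norm (g x)) summable_on B"
  shows "((\<lambda>(x, y). f x * g y) has_sum (infsum f A * infsum g B)) (A \<times> B)"
proof -
  have "(\<lambda>z. norm (case z of (x, y) \<Rightarrow> f x * g y)) summable_on A \<times> B"
    unfolding Infinite_Sum.abs_summable_on_Sigma_iff
    using assms by (auto simp: abs_mult infsum_cmult_right' intro!: summable_on_cmult_right
        summable_on_cmult_left)
  hence S: "(\<lambda>(x, y). f x * g y) summable_on A \<times> B"
    by (rule abs_summable_summable)
  have "infsum (\<lambda>(x, y). f x * g y) (A \<times> B) = infsum f A * infsum g B"
    using infsum_Sigma'_banach[OF S] by (simp add: infsum_cmult_right' infsum_cmult_left')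
  thus ?thesis using S by (metis has_sum_infsum)
qed

text \<open>
  Splitting the double series by the parity of the exponent of \<open>x\<close> exhibits
  \<open>\<theta>(xy) \<theta>(x/y) / x\<close> as an alternating form of rank two; the three-term
  relation is then a Pluecker relation.
\<close>

lemma theta_mult:
  assumes p: "0 < p" "p < 1" and x: "x \<noteq> 0" and y: "y \<noteq> 0"
  shows "(qpoch (p\<^sup>2) (p\<^sup>2))\<^sup>2 * (theta (x * y) (p\<^sup>2) * theta (x / y)
      (p\<^sup>2)) =
    x * (theta1 p x * theta0 p y - theta0 p x * theta1 p y)"
proof -
  define f where "f = theta_term p (-(x * y))"
  define g where "g = theta_term p (-(x / y))"
  define E where "E = qpoch (p\<^sup>2) (p\<^sup>2)"
  define F where "F = (\<lambda>(m, n). f m * g n)"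
  define u v where "u k = p powi (2 * k\<^sup>2) * x powi (2 * k)" and
    "v k = p powi (2 * k\<^sup>2 + 2 * k) * x powi (2 * k + 1)" for k :: int
  define u' v' where "u' k = p powi (2 * k\<^sup>2) * y powi (2 * k)" and
    "v' k = p powi (2 * k\<^sup>2 + 2 * k) * y powi (2 * k + 1)" for k :: int
  have sf: "(f has_sum (E * theta (x * y) (p\<^sup>2))) UNIV"
    using triple_product[OF p, of "-(x * y)"] x y by (simp add: f_def E_def theta_def mult.assoc)
  have sg: "(g has_sum (E * theta (x / y) (p\<^sup>2))) UNIV"
    using triple_product[OF p, of "-(x / y)"] x y by (simp add: g_def E_def theta_def mult.assoc)
  have "(F has_sum (infsum f UNIV * infsum g UNIV)) (UNIV \<times> UNIV)"
    unfolding F_def f_def g_def using p x y by (intro has_sum_product theta_term_abs_summable) auto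
  hence total: "(F has_sum (E * theta (x * y) (p\<^sup>2) * (E * theta (x / y) (p\<^sup>2)))) UNIV"
    using infsumI[OF sf] infsumI[OF sg] by simp
  have fg: "f m * g n = (-1) powi (m + n) * p powi (m * (m - 1) + n * (n - 1)) * (x powi (m
      + n) * y powi (m - n))" for m n
  proof -
    have f': "f m = (-1) powi m * p powi (m * (m - 1)) * (x powi m * y powi m)"
      unfolding f_def theta_term_def using x y
      by (simp add: power_int_mult_distrib[of "-1" "x * y", simplified] power_int_mult_distrib mult_ac)
    have g': "g n = (-1) powi n * p powi (n * (n - 1)) * (x powi n / y powi n)"
      unfolding g_def theta_term_def using x y
      by (simp add: power_int_mult_distrib[of "-1" "x / y", simplified] power_int_divide_distrib mult_ac)
    show ?thesis unfolding f' g' using p x y by (simp add: power_int_add power_int_diff)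
  qed
  \<comment> \<open>For \<open>m + n\<close> even, put \<open>m = j + k\<close> and
    \<open>n = j - k\<close>: the quadratic exponent of \<open>p\<close> splits into a part in
    \<open>j\<close> and a part in \<open>k\<close>. The part in \<open>j\<close> is that of
    \<open>v (j - 1)\<close>, with one factor \<open>x\<close> left over.\<close>
  have ev: "F (j + k, j - k) = v (j - 1) * x * u' k" for j k
  proof -
    have "F (j + k, j - k) = (-1) powi (2 * j) * p powi ((j + k) * (j + k - 1)
        + (j - k) * (j - k - 1)) * (x powi (2 * j) * y powi (2 * k))"
      unfolding F_def by (simp add: fg algebra_simps)
    also have "(-1 :: real) powi (2 * j) = 1" by (simp add: power_int_mult)
    also have "(j + k) * (j + k - 1) + (j - k) * (j - k - 1) = (2 * (j - 1)\<^sup>2 + 2 * (j - 1))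
        + 2 * k\<^sup>2"
      by (simp add: algebra_simps power2_eq_square)
    also have "x powi (2 * j) = x powi (2 * (j - 1) + 1) * x"
    proof -
      have "2 * j = (2 * (j - 1) + 1) + 1" by simp
      thus ?thesis using x by (metis power_int_add power_int_1_right)
    qed
    finally show ?thesis using p by (simp add: u'_def v_def power_int_add mult_ac)
  qed
  \<comment> \<open>For \<open>m + n\<close> odd the two series exchange roles and the sign is
    negative, which makes the form alternating.\<close>
  have od: "F (j + k + 1, j - k) = - (u j * x * v' k)" for j k
  proof -
    have "F (j + k + 1, j - k) = (-1) powi (2 * j + 1) * p powi ((j + k + 1) * (j + k)
        + (j - k) * (j - k - 1)) * (x powi (2 * j + 1) * y powi (2 * k + 1))"
      unfolding F_def by (simp add: fg algebra_simps)
    also have "(-1 :: real) powi (2 * j + 1) = -1" by (simp add: power_int_mult power_int_add)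
    also have "(j + k + 1) * (j + k) + (j - k) * (j - k - 1) = 2 * j\<^sup>2 + (2 * k\<^sup>2 + 2 * k)"
      by (simp add: algebra_simps power2_eq_square)
    finally show ?thesis using p x by (simp add: u_def v'_def power_int_add mult_ac)
  qed
  have nu: "(\<lambda>k. norm (u k)) summable_on UNIV" "(\<lambda>k. norm (u' k)) summable_on UNIV"
    unfolding u_def u'_def using theta_series0 p x y by blast+
  have nv: "(\<lambda>k. norm (v k)) summable_on UNIV" "(\<lambda>k. norm (v' k)) summable_on UNIV"
    unfolding v_def v'_def using theta_series1 p x y by blast+
  have inf: "infsum u UNIV = theta0 p x" "infsum v UNIV = theta1 p x"
    "infsum u' UNIV = theta0 p y" "infsum v' UNIV = theta1 p y"
    by (simp_all add: u_def[abs_def] u'_def[abs_def] v_def[abs_def] v'_def[abs_def] theta0_def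
        theta1_def)
  define A B where "A = {(m, n). even (m + n :: int)}" and "B = {(m, n). odd (m + n :: int)}"
  have "((\<lambda>(j, k). v j * u' k) has_sum (theta1 p x * theta0 p y)) (UNIV \<times> UNIV)"
    using has_sum_product[OF nv(1) nu(2)] by (simp add: inf)
  hence "((\<lambda>z. x * (case z of (j, k) \<Rightarrow> v j * u' k))
      has_sum (x * (theta1 p x * theta0 p y))) UNIV"
    by (intro has_sum_cmult_right) simp
  also have "?this \<longleftrightarrow> (F has_sum (x * (theta1 p x * theta0 p y))) A"
  \<comment> \<open>Using \<open>j + 1\<close> for \<open>j\<close> undoes the index shift in
    \<open>ev\<close>.\<close>
  proof (rule has_sum_reindex_bij_witness[of _ "\<lambda>(m, n). ((m
      + n) div 2 - 1, (m - n) div 2)" "\<lambda>(j, k). (j + 1 + k, j + 1 - k)"])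
    show "F (case z of (j, k) \<Rightarrow> (j + 1 + k, j + 1 - k))
        = x * (case z of (j, k) \<Rightarrow> v j * u' k)" for z
      by (cases z) (simp only: prod.case ev[of "fst z + 1"], simp add: ev mult_ac)
  qed (auto simp: A_def, presburger+)
  finally have sA: "(F has_sum (x * (theta1 p x * theta0 p y))) A" .
  have "((\<lambda>(j, k). u j * v' k) has_sum (theta0 p x * theta1 p y)) (UNIV \<times> UNIV)"
    using has_sum_product[OF nu(1) nv(2)] by (simp add: inf)
  hence "((\<lambda>z. (-x) * (case z of (j, k) \<Rightarrow> u j * v' k))
      has_sum ((-x) * (theta0 p x * theta1 p y))) UNIV"
    by (intro has_sum_cmult_right) simp
  also have "?this \<longleftrightarrow> (F has_sum ((-x) * (theta0 p x * theta1 p y))) B"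
  proof (rule has_sum_reindex_bij_witness[of _ "\<lambda>(m, n). ((m
      + n) div 2, (m - n) div 2)" "\<lambda>(j, k). (j + k + 1, j - k)"])
    show "F (case z of (j, k) \<Rightarrow> (j + k + 1, j - k))
        = (-x) * (case z of (j, k) \<Rightarrow> u j * v' k)" for z
      by (cases z) (simp add: od mult_ac)
  qed (auto simp: B_def, presburger+)
  finally have sB: "(F has_sum ((-x) * (theta0 p x * theta1 p y))) B" .
  have "(F has_sum (x * (theta1 p x * theta0 p y) + (-x) * (theta0 p x * theta1 p y))) (A \<union> B)"
    using sA sB by (rule has_sum_Un_disjoint) (auto simp: A_def B_def)
  also have "A \<union> B = UNIV" by (auto simp: A_def B_def)
  finally show ?thesis using total has_sum_unique
    by (fastforce simp: E_def power2_eq_square algebra_simps)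
qed

text \<open>By \<open>theta_mult\<close>, each \<open>W x y\<close> is \<open>x * D x y / E\<close>
  with \<open>D\<close> a 2 by 2 determinant, and \<open>pl\<close> relates the minors of a 2 by 4
  matrix. The prefactors \<open>b\<close> and \<open>c\<close> give all three terms the same factor
  \<open>a * b * c\<close>.\<close>

lemma theta_three_term:
  assumes q: "0 < q" "q < 1" and nz: "a \<noteq> 0" "b \<noteq> 0" "c \<noteq> 0" "d \<noteq> 0"
  shows "b * (theta (a * b) q * theta (a / b) q * (theta (c * d) q * theta (c / d) q)) +
         c * (theta (a * d) q * theta (a / d) q * (theta (b * c) q * theta (b / c) q)) =
         c * (theta (a * c) q * theta (a / c) q * (theta (b * d) q * theta (b / d) q))"
proof -
  define p where "p = sqrt q"
  have p: "0 < p" "p < 1" and pq: "p\<^sup>2 = q" using q by (auto simp: p_def)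
  define E where "E = (qpoch q q)\<^sup>2"
  have E: "E \<noteq> 0" unfolding E_def using q qpoch_nonzero[of q q] by simp
  define W where "W x y = theta (x * y) q * theta (x / y) q" for x y
  define D where "D x y = theta1 p x * theta0 p y - theta0 p x * theta1 p y" for x y
  have WD: "W x y = x * D x y / E" if "x \<noteq> 0" "y \<noteq> 0" for x y
    using theta_mult[OF p that] E unfolding pq W_def D_def E_def by (simp add: field_simps)
  have pl: "D a b * D c d + D a d * D b c = D a c * D b d"
    unfolding D_def by (simp add: algebra_simps)
  have "b * (W a b * W c d) + c * (W a d * W b c) = a * b * c * (D a b * D c d
      + D a d * D b c) / E\<^sup>2"
    using nz E by (simp add: WD field_simps power2_eq_square)
  also have "\<dots> = c * (W a c * W b d)"
    using nz E unfolding pl by (simp add: WD field_simps power2_eq_square)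
  finally show ?thesis unfolding W_def .
qed

subsection \<open>Generating functions of partitions\<close>

lemma power_series_coeff_0:
  fixes c :: "nat \<Rightarrow> real"
  assumes c: "\<And>q. 0 < q \<Longrightarrow> q < 1 \<Longrightarrow> (\<lambda>n. c n * q ^ n) sums 0"
  shows "c 0 = 0"
proof -
  have "(\<lambda>n. c n * x ^ n) sums (\<Sum>n. c n * x ^ n)" if "norm x < 1" for x
  proof (rule summable_sums, rule powser_inside)
    \<comment> \<open>The midpoint of \<open>\<bar>x\<bar>\<close> and 1 is positive even when
      \<open>x\<close> is not, so the hypothesis gives convergence there and hence at
      \<open>x\<close>.\<close>
    show "summable (\<lambda>n. c n * ((1 + \<bar>x\<bar>) / 2) ^ n)"
      using c[of "(1 + \<bar>x\<bar>) / 2"] that by (auto simp: sums_iff)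
  qed (use that in auto)
  hence "((\<lambda>x. \<Sum>n. c n * x ^ n) \<longlongrightarrow> c 0) (at 0)"
    by (intro powser_limit_0[of 1]) auto
  \<comment> \<open>The sum is known to vanish only at positive arguments, hence the one-sided
    limit.\<close>
  hence lim: "((\<lambda>x. \<Sum>n. c n * x ^ n) \<longlongrightarrow> c 0) (at_right 0)"
    by (simp add: filterlim_at_split)
  have "eventually (\<lambda>x. (0::real) < x \<and> x < 1) (at_right 0)"
    unfolding eventually_at_right[OF zero_less_one] by (auto intro!: exI[of _ 1])
  hence "eventually (\<lambda>x. (\<Sum>n. c n * x ^ n) = 0) (at_right 0)"
    by eventually_elim (use c in \<open>auto simp: sums_iff\<close>)
  hence "((\<lambda>x. \<Sum>n. c n * x ^ n) \<longlongrightarrow> 0) (at_right 0)"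
      by (rule tendsto_eventually)
  from tendsto_unique[OF _ lim this] show ?thesis by simp
qed

text \<open>Once \<open>c 0\<close> is zero, division by \<open>q\<close> leaves a series of the
  same kind with shifted coefficients.\<close>

lemma power_series_coeffs_zero:
  fixes c :: "nat \<Rightarrow> real"
  assumes "\<And>q. 0 < q \<Longrightarrow> q < 1 \<Longrightarrow> (\<lambda>n. c n * q ^ n) sums 0"
  shows "c n = 0"
  using assms
proof (induction n arbitrary: c)
  case 0
  thus ?case by (rule power_series_coeff_0)
next
  case (Suc n)
  have c0: "c 0 = 0" using Suc.prems by (rule power_series_coeff_0)
  show ?case
  proof (rule Suc.IH[of "\<lambda>n. c (Suc n)"])
    fix q :: real assume q: "0 < q" "q < 1"
    have "(\<lambda>n. c (Suc n) * q ^ Suc n) sums 0"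
      using Suc.prems[OF q] c0 sums_Suc_iff[of "\<lambda>n. c n * q ^ n" 0] by simp
    hence "(\<lambda>n. inverse q * (c (Suc n) * q ^ Suc n)) sums (inverse q * 0)" by (rule sums_mult)
    moreover have "inverse q * (c (Suc n) * q ^ Suc n) = c (Suc n) * q ^ n" for n
      using q by (simp add: field_simps)
    ultimately show "(\<lambda>n. c (Suc n) * q ^ n) sums 0" by (simp only: mult_zero_right)
  qed
qed

section \<open>Partitions into prescribed parts and infinite products\<close>

lemma num_partitions_insert:
  assumes "0 \<notin> S" "s \<notin> S" "0 < s"
  shows "num_partitions (insert s S) n = num_partitions S n +
    (if s \<le> n then num_partitions (insert s S) (n - s) else 0)"
proof -
  \<comment> \<open>The partitions that contain \<open>s\<close>, with one copy of \<open>s\<close>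
    removed. There are none for \<open>s > n\<close>, where the truncated difference would wrongly
    give the empty partition.\<close>
  define A where "A = (if s \<le> n then partitions_into (insert s S) (n - s) else {})"
  have fin: "finite (partitions_into S n)" "finite A"
    using assms finite_partitions_into[of "insert s S"] finite_partitions_into[of S]
        by (auto simp: A_def)
  have "partitions_into (insert s S) n = partitions_into S n \<union> add_mset s ` A"
  proof (intro equalityI subsetI)
    fix P assume P: "P \<in> partitions_into (insert s S) n"
    show "P \<in> partitions_into S n \<union> add_mset s ` A"
    proof (cases "s \<in># P")
      case True
      then obtain P' where P': "P = add_mset s P'" by (metis mset_add)
      hence "P' \<in> A" using P by (auto simp: A_def partitions_into_def)
      thus ?thesis using P' by blast
    next
      case False
      thus ?thesis using P by (auto simp: partitions_into_def)
    qed
  qed (auto simp: A_def partitions_into_def split: if_splits)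
  moreover have "partitions_into S n \<inter> add_mset s ` A = {}"
    using assms by (auto simp: partitions_into_def)
  moreover have "card (add_mset s ` A) = card A" by (rule card_image) (auto simp: inj_on_def)
  ultimately show ?thesis
    using fin by (simp add: num_partitions_def card_Un_disjoint A_def)
qed

text \<open>Adjoining a part \<open>s\<close> turns the recursion of
  \<open>num_partitions_insert\<close> into \<open>G = F + q ^ s * G\<close>, once the new series is
  known to converge.\<close>

lemma partition_gf_finite:
  fixes q :: real
  assumes q: "0 < q" "q < 1" and "finite S" "0 \<notin> S"
  shows "(\<lambda>n. num_partitions S n * q ^ n) sums (1 / (\<Prod>s\<in>S. 1 - q ^ s))"
  using assms(3,4)
proof (induction S rule: finite_induct)
  case empty
  have "num_partitions {} n = (if n = 0 then 1 else 0)" for n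
    by (cases n) (simp_all add: num_partitions_0, simp add: num_partitions_def partitions_into_def)
  hence "num_partitions {} n * q ^ n = (if n = 0 then 1 else 0)" for n by simp
  thus ?case using sums_single[of 0 "\<lambda>_. 1::real"] by simp
next
  case (insert s S)
  define a where "a n = num_partitions S n * q ^ n" for n
  define b where "b n = num_partitions (insert s S) n * q ^ n" for n
  define F where "F = 1 / (\<Prod>s\<in>S. 1 - q ^ s)"
  have s: "s > 0" and S: "0 \<notin> S" using insert.prems by auto
  have a: "a sums F" unfolding a_def F_def using insert.IH S by simp
  have nn: "a n \<ge> 0" "b n \<ge> 0" for n using q by (auto simp: a_def b_def)
  have qs: "q ^ s < 1" using q s by (simp add: power_less_one_iff)
  have rec: "b n = a n + (if s \<le> n then q ^ s * b (n - s) else 0)" for n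
  proof -
    have "q ^ n = q ^ s * q ^ (n - s)" if "s \<le> n" using that by (simp flip: power_add)
    thus ?thesis
      unfolding a_def b_def using num_partitions_insert[OF S insert.hyps(2) s, of n]
      by (auto simp: algebra_simps)
  qed
  \<comment> \<open>Convergence: by the recursion, each partial sum is at most \<open>F\<close> plus
    \<open>q ^ s\<close> times itself.\<close>
  have "(\<Sum>n<N. b n) \<le> F / (1 - q ^ s)" for N
  proof -
    have "(\<Sum>n<N. if s \<le> n then b (n - s) else 0) = (\<Sum>n\<in>{s..<N}. b (n - s))"
      by (subst sum.inter_filter[symmetric]) (auto intro!: sum.cong)
    also have "\<dots> = (\<Sum>m<N - s. b m)"
      by (rule sum.reindex_bij_witness[of _ "\<lambda>m. m + s" "\<lambda>n. n - s"]) auto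
    also have "\<dots> \<le> (\<Sum>n<N. b n)" by (rule sum_mono2) (use nn in auto)
    finally have le: "(\<Sum>n<N. if s \<le> n then b (n - s) else 0) \<le> (\<Sum>n<N. b n)" .
    have "(\<Sum>n<N. b n) = (\<Sum>n<N. a n) + (\<Sum>n<N. if s \<le> n then q ^ s * b (n - s) else 0)"
      unfolding sum.distrib[symmetric] by (intro sum.cong refl rec)
    also have "(\<Sum>n<N. if s \<le> n then q ^ s * b (n - s) else 0)
        = q ^ s * (\<Sum>n<N. if s \<le> n then b (n - s) else 0)"
      unfolding sum_distrib_left by (intro sum.cong) auto
    also have "\<dots> \<le> q ^ s * (\<Sum>n<N. b n)" using le q by (intro mult_left_mono) auto
    also have "(\<Sum>n<N. a n) \<le> F"
      using sum_le_suminf[of a "{..<N}"] a nn by (auto simp: sums_iff)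
    finally show ?thesis using qs by (simp add: field_simps)
  qed
  hence "summable b" using nn by (intro summableI_nonneg_bounded) auto
  then obtain G where G: "b sums G" by blast
  have "(\<lambda>n. if s \<le> n then q ^ s * b (n - s) else 0) sums (q ^ s * G)"
    using sums_mult[OF G, of "q ^ s"] by (subst sums_zero_iff_shift[of s, symmetric]) auto
  from sums_add[OF a this] have "b sums (F + q ^ s * G)" by (simp flip: rec)
  hence "G = F + q ^ s * G" using G sums_unique2 by blast
  hence "G = F / (1 - q ^ s)" using qs by (simp add: field_simps)
  thus ?case using G insert.hyps by (simp add: b_def[abs_def] F_def mult.commute)
qed

lemma part_le_sum_mset: "x \<in># P \<Longrightarrow> x \<le> sum_mset (P :: nat multiset)"
  by (metis le_add1 mset_add sum_mset.add_mset)

text \<open>The finite sets \<open>A N\<close> exhaust \<open>S\<close>, and coefficients up to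
  \<open>N\<close> already agree. With \<open>F\<close> the sum of the full series,
  \<open>P N\<close> is squeezed between its partial sum up to \<open>N\<close> and
  \<open>F\<close>. The lower bound comes first, since it also yields convergence.\<close>

lemma partition_gf:
  fixes q :: real
  assumes q: "0 < q" "q < 1" and S: "0 \<notin> S"
    and A: "\<And>N. finite (A N)" "\<And>N. A N \<subseteq> S" "\<And>N. S \<inter> {..N} \<subseteq>
        A N"
    and lim: "(\<lambda>N. \<Prod>s\<in>A N. 1 - q ^ s)
        \<longlonglongrightarrow> L" and L: "L \<noteq> 0"
  shows "(\<lambda>n. num_partitions S n * q ^ n) sums (1 / L)"
proof -
  define a where "a n = num_partitions S n * q ^ n" for n
  define P where "P N = 1 / (\<Prod>s\<in>A N. 1 - q ^ s)" for N
  have P: "P \<longlonglongrightarrow> 1 / L" unfolding P_def[abs_def] using L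
      by (intro tendsto_divide lim tendsto_const)
  have 0: "0 \<notin> A N" for N using A(2) S by blast
  have gf: "(\<lambda>n. num_partitions (A N) n * q ^ n) sums P N" for N
    unfolding P_def by (rule partition_gf_finite[OF q A(1) 0])
  have le: "num_partitions (A N) n \<le> num_partitions S n" for N n
    unfolding num_partitions_def
    using A(2)[of N] S by (intro card_mono finite_partitions_into) (auto simp: partitions_into_def)
  have eq: "num_partitions (A N) n = num_partitions S n" if "n < Suc N" for N n
  proof -
    have "partitions_into (A N) n = partitions_into S n"
      using A(2)[of N] A(3)[of N] that by (fastforce simp: partitions_into_def dest: part_le_sum_mset)
    thus ?thesis by (simp add: num_partitions_def)
  qed
  have nn: "a n \<ge> 0" for n using q by (simp add: a_def)
  have partial: "(\<Sum>n<Suc N. a n) \<le> P N" for N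
  proof -
    have "(\<Sum>n<Suc N. a n) = (\<Sum>n<Suc N. num_partitions (A N) n * q ^ n)"
      by (rule sum.cong) (auto simp: a_def eq)
    also have "\<dots> \<le> P N"
      using gf[of N] q sum_le_suminf[of "\<lambda>n. num_partitions (A N) n * q ^ n" "{..<Suc N}"]
      by (auto simp: sums_iff)
    finally show ?thesis .
  qed
  obtain K where K: "\<And>N. P N \<le> K"
    using convergent_imp_Bseq[OF convergentI[OF P]] by (metis BseqD abs_le_D1 real_norm_def)
  have "summable a"
  proof (rule summableI_nonneg_bounded)
    fix N show "(\<Sum>n<N. a n) \<le> K"
      using partial[of N] K[of N] nn[of N] by simp
  qed (use nn in auto)
  then obtain F where F: "a sums F" by blast
  have "P N \<le> F" for N
    using gf[of N] F le q by (intro sums_le[OF _ gf F]) (auto simp: a_def intro!: mult_right_mono)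
  moreover have "(\<lambda>N. \<Sum>n<Suc N. a n) \<longlonglongrightarrow> F"
    using F unfolding sums_def by (rule LIMSEQ_Suc)
  ultimately have "P \<longlonglongrightarrow> F"
    using partial by (intro tendsto_sandwich[OF _ _ _ tendsto_const, of "\<lambda>N. \<Sum>n<Suc N. a
        n" P sequentially F]) auto
  with P have "F = 1 / L" using LIMSEQ_unique by blast
  thus ?thesis using F by (simp add: a_def[abs_def])
qed

lemma partition_gf_residues:
  fixes q :: real
  assumes q: "0 < q" "q < 1" and R: "R \<subseteq> {0<..<M}"
  shows "(\<lambda>n. num_partitions {n. n mod M \<in> R} n * q ^ n)
      sums (1 / (\<Prod>r\<in>R. qpoch (q ^ r) (q ^ M)))"
proof (cases "M = 0")
  case False
  \<comment> \<open>The first \<open>N + 1\<close> members of each residue class: a set containing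
    all parts up to \<open>N\<close> whose product splits into partial products of
    \<open>qpoch\<close>.\<close>
  define A where "A N = (\<lambda>(r, n). r + M * n) ` (R \<times> {..<Suc N})" for N
  have M: "M > 0" using False by simp
  have qM: "\<bar>q ^ M\<bar> < 1" using q M by (simp add: power_less_one_iff)
  have finR: "finite R" using R finite_subset by blast
  have r: "0 < r" "r < M" if "r \<in> R" for r using R that by auto
  have inj: "inj_on (\<lambda>(r, n). r + M * n) (R \<times> {..<Suc N})" for N
  proof (rule inj_onI, clarsimp)
    fix r n r' n' assume H: "r \<in> R" "r' \<in> R" "r + M * n = r' + M * n'"
    have "(r + M * n) mod M = r" "(r' + M * n') mod M = r'"
      using r(2)[OF H(1)] r(2)[OF H(2)] by simp_all
    with H have "r = r'" by simp
    thus "r = r' \<and> n = n'" using H M by simp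
  qed
  have prod: "(\<Prod>s\<in>A N. 1 - q ^ s)
      = (\<Prod>r\<in>R. \<Prod>n<Suc N. 1 - q ^ r * (q ^ M) ^ n)" for N
    unfolding A_def prod.reindex[OF inj]
    by (subst prod.cartesian_product) (auto intro!: prod.cong simp: power_add power_mult)
  show ?thesis
  proof (rule partition_gf[OF q, where A = A])
    show "0 \<notin> {n. n mod M \<in> R}" using r by auto
    show "finite (A N)" for N unfolding A_def using finR by blast
    show "A N \<subseteq> {n. n mod M \<in> R}" for N unfolding A_def using r by auto
    show "{n. n mod M \<in> R} \<inter> {..N} \<subseteq> A N" for N
    proof
      fix n assume n: "n \<in> {n. n mod M \<in> R} \<inter> {..N}"
      have "n \<le> N" using n by simp
      hence "n div M < Suc N" using div_le_dividend[of n M] by linarith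
      moreover have "n = n mod M + M * (n div M)" by simp
      ultimately show "n \<in> A N" using n unfolding A_def
          by (force intro!: image_eqI[of _ _ "(n mod M, n div M)"])
    qed
    show "(\<lambda>N. \<Prod>s\<in>A N. 1 - q ^ s)
        \<longlonglongrightarrow> (\<Prod>r\<in>R. qpoch (q ^ r) (q ^ M))"
      unfolding prod by (intro tendsto_prod LIMSEQ_Suc qpoch_LIMSEQ qM)
    have "qpoch (q ^ r) (q ^ M) \<noteq> 0" if "r \<in> R" for r
      using q r(1)[OF that] by (intro qpoch_nonzero qM) (simp add: power_less_one_iff)
    thus "(\<Prod>r\<in>R. qpoch (q ^ r) (q ^ M)) \<noteq> 0" using finR by simp
  qed
next
  case True
  hence "R = {}" using R by auto
  thus ?thesis using partition_gf_finite[OF q, of "{}"] by (simp)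
qed

text \<open>Comparison of coefficients: \<open>q ^ e\<close> shifts the index by \<open>e\<close>,
  and \<open>q ^ d\<close> accounts for the single exceptional \<open>n\<close>.\<close>

lemma shifted_partition_identity:
  fixes f g :: "real \<Rightarrow> real"
  assumes S: "\<And>q::real. 0 < q \<Longrightarrow> q < 1 \<Longrightarrow> (\<lambda>n.
      num_partitions S n * q ^ n) sums f q"
    and T: "\<And>q::real. 0 < q \<Longrightarrow> q < 1 \<Longrightarrow> (\<lambda>n. num_partitions
        T n * q ^ n) sums g q"
    and fg: "\<And>q::real. 0 < q \<Longrightarrow> q < 1 \<Longrightarrow> f q = q ^ e * g q + q ^ d"
  shows "num_partitions S n = (if e \<le> n then num_partitions T (n - e) else 0) + (if n
      = d then 1 else 0)"
proof -
  define b where "b n = (if e \<le> n then num_partitions T (n - e) else 0) + (if n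
      = d then 1 else 0)" for n
  have "real (num_partitions S n) - real (b n) = 0"
  proof (rule power_series_coeffs_zero[where c = "\<lambda>n. real (num_partitions S n) - real (b n)"])
    fix q :: real assume q: "0 < q" "q < 1"
    have "(\<lambda>n. q ^ e * (num_partitions T n * q ^ n)) sums (q ^ e * g q)"
      by (rule sums_mult[OF T[OF q]])
    hence "(\<lambda>n. (if e \<le> n then num_partitions T (n - e) * q ^ n else 0)) sums (q ^ e * g q)"
      by (subst sums_zero_iff_shift[of e, symmetric]) (auto simp: power_add mult_ac)
    moreover have "(\<lambda>n. if n = d then q ^ n else 0) sums q ^ d" by (rule sums_single)
    ultimately have "(\<lambda>n. (if e \<le> n then num_partitions T (n - e) * q ^ n else 0)
        + (if n = d then q ^ n else 0)) sums f q"
      unfolding fg[OF q] by (rule sums_add)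
    from sums_diff[OF S[OF q] this]
    have "(\<lambda>n. num_partitions S n * q ^ n - ((if e \<le> n then num_partitions T (n - e) * q ^
        n else 0) +
        (if n = d then q ^ n else 0))) sums 0" by simp
    moreover have "num_partitions S n * q ^ n - ((if e \<le> n then num_partitions T (n - e) * q ^ n
        else 0) +
        (if n = d then q ^ n else 0)) = (real (num_partitions S n) - real (b n)) * q ^ n" for n
      by (simp add: b_def algebra_simps)
    ultimately show "(\<lambda>n. (real (num_partitions S n) - real (b n)) * q ^ n) sums 0" by simp
  qed
  thus ?thesis by (simp add: b_def)
qed

subsection \<open>Level 60\<close>

text \<open>For \<open>0 < q < 1\<close> and \<open>0 < r < 30\<close>, the product of
  \<open>1 - q ^ s\<close> over all positive \<open>s\<close> congruent to \<open>r\<close> or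
  \<open>- r\<close> modulo 60; equivalently \<open>theta (q ^ r) (q ^ 60)\<close>.\<close>

definition g60 :: "real \<Rightarrow> nat \<Rightarrow> real" where
  "g60 q r = qpoch (q ^ r) (q ^ 60) * qpoch (q ^ (60 - r)) (q ^ 60)"

lemma g60_nonzero:
  assumes "0 < q" "q < 1" "0 < r" "r < 60"
  shows "g60 q r \<noteq> 0"
proof -
  have "qpoch (q ^ n) (q ^ 60) \<noteq> 0" if "n > 0" for n
    using assms that by (intro qpoch_nonzero) (simp_all add: power_less_one_iff)
  thus ?thesis using assms by (simp add: g60_def)
qed

text \<open>Bisecting both symbols in base \<open>q ^ 30\<close> yields the classes
  \<open>r\<close>, \<open>30 + r\<close>, \<open>30 - r\<close>, \<open>60 - r\<close>. For the
  second formula, the thetas at \<open>q ^ r\<close> and \<open>- (q ^ r)\<close> multiply to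
  \<open>g60 q (2 * r)\<close> by pairing opposite signs, and the first one is divided out.\<close>

lemma theta_g60:
  assumes q: "0 < q" "q < 1" and r: "0 < r" "r < 30"
  shows "theta (q ^ r) (q ^ 30) = g60 q r * g60 q (30 - r)"
    and "theta (- (q ^ r)) (q ^ 30) = g60 q (2 * r) / (g60 q r * g60 q (30 - r))"
proof -
  have q30: "\<bar>q ^ 30\<bar> < 1" using q by (simp add: power_less_one_iff)
  have sq: "(q ^ 30)\<^sup>2 = q ^ 60" by (simp flip: power_mult)
  have div: "q ^ 30 / q ^ r = q ^ (30 - r)" using q r by (simp add: power_diff)
  have "30 - (30 - r) = r" "60 - (30 - r) = 30 + r" "30 - r + 30 = 60 - r" using r by simp_all
  thus 1: "theta (q ^ r) (q ^ 30) = g60 q r * g60 q (30 - r)"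
    using qpoch_bisect[OF q30, of "q ^ r"] qpoch_bisect[OF q30, of "q ^ (30 - r)"]
    by (simp add: theta_def g60_def div sq power_add[symmetric] add.commute mult_ac)
  have "theta (- (q ^ r)) (q ^ 30) * theta (q ^ r) (q ^ 30) =
     (qpoch (- (q ^ r)) (q ^ 30) * qpoch (q ^ r) (q ^ 30)) *
     (qpoch (- (q ^ (30 - r))) (q ^ 30) * qpoch (q ^ (30 - r)) (q ^ 30))"
    by (simp add: theta_def div)
  also have "\<dots> = g60 q (2 * r)"
    unfolding qpoch_mult_minus[OF q30] sq g60_def
    by (simp add: power_mult[symmetric] mult.commute diff_mult_distrib2)
  finally show "theta (- (q ^ r)) (q ^ 30) = g60 q (2 * r) / (g60 q r * g60 q (30 - r))"
    using g60_nonzero[OF q, of r] g60_nonzero[OF q, of "30 - r"] r unfolding 1 by (simp add: field_simps)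
qed

definition theta30 :: "real \<Rightarrow> real \<Rightarrow> nat \<Rightarrow> real" where
  "theta30 q \<sigma> r = theta (\<sigma> * q ^ r) (q ^ 30)"

lemma theta30_g60:
  assumes q: "0 < q" "q < 1" and r: "0 < r" "r < 30"
  shows "theta30 q 1 r = g60 q r * g60 q (30 - r)"
    and "theta30 q (-1) r = g60 q (2 * r) / (g60 q r * g60 q (30 - r))"
  using theta_g60[OF assms] by (simp_all add: theta30_def)

text \<open>Brings the index \<open>2 * r\<close> from \<open>theta30_g60\<close> back below
  30.\<close>

lemma g60_reflect: "30 < r \<Longrightarrow> r < 60 \<Longrightarrow> g60 q r = g60 q (60 - r)"
  by (simp add: g60_def mult.commute)

text \<open>Signs are their own inverses, so for signed powers of \<open>q\<close> a quotient
  multiplies the signs and subtracts the exponents; the ordering keeps these differences natural.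
  The common factor \<open>q ^ C\<close> is cancelled.\<close>

lemma theta30_three_term:
  assumes q: "0 < q" "q < 1" and ord: "D \<le> C" "C \<le> B" "B \<le> A"
    and signs: "\<alpha>\<^sup>2 = 1" "\<beta>\<^sup>2 = 1" "\<gamma>\<^sup>2 = 1" "\<delta>\<^sup>2 = 1"
  shows "\<beta> * q ^ (B - C) * (theta30 q (\<alpha> * \<beta>) (A
      + B) * theta30 q (\<alpha> * \<beta>) (A - B) *
           (theta30 q (\<gamma> * \<delta>) (C + D) * theta30 q (\<gamma> * \<delta>) (C - D))) +
         \<gamma> * (theta30 q (\<alpha> * \<delta>) (A + D) * theta30 q (\<alpha> * \<delta>) (A - D) *
           (theta30 q (\<beta> * \<gamma>) (B + C) * theta30 q (\<beta> * \<gamma>) (B - C))) =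
         \<gamma> * (theta30 q (\<alpha> * \<gamma>) (A + C) * theta30 q (\<alpha> * \<gamma>) (A - C) *
           (theta30 q (\<beta> * \<delta>) (B + D) * theta30 q (\<beta> * \<delta>) (B - D)))"
    (is "\<beta> * q ^ (B - C) * ?X + \<gamma> * ?Y = \<gamma> * ?Z")
proof -
  have inv: "1 / \<sigma> = \<sigma>" if "\<sigma>\<^sup>2 = 1" for \<sigma> :: real
    using that by (auto simp: power2_eq_1_iff)
  have mult: "(\<sigma> * q ^ m) * (\<tau> * q ^ n) = \<sigma> * \<tau> * q ^ (m
      + n)" for \<sigma> \<tau> m n
    by (simp add: power_add)
  have div: "(\<sigma> * q ^ m) / (\<tau> * q ^ n)
      = \<sigma> * \<tau> * q ^ (m - n)" if "\<tau>\<^sup>2 = 1" "n \<le> m" for \<sigma> \<tau> m n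
  proof -
    have "(\<sigma> * q ^ m) / (\<tau> * q ^ n) = \<sigma> * (1 / \<tau>) * (q ^ m / q ^ n)" by simp
    also have "\<dots> = \<sigma> * \<tau> * q ^ (m - n)"
      using that q power_diff[of q n m] by (simp add: inv)
    finally show ?thesis .
  qed
  have nz: "\<sigma> * q ^ n \<noteq> 0" if "\<sigma>\<^sup>2 = 1" for \<sigma> n using that q by auto
  have q30: "0 < q ^ 30" "q ^ 30 < 1" using q by (simp_all add: power_less_one_iff)
  have "\<beta> * q ^ B * ?X + \<gamma> * q ^ C * ?Y = \<gamma> * q ^ C * ?Z"
    using theta_three_term[OF q30 nz[OF signs(1), of A] nz[OF signs(2), of B] nz[OF signs(3), of C]
        nz[OF signs(4), of D]]
      ord signs
    by (simp only: mult div theta30_def le_trans[OF ord(1,2)] le_trans[OF ord(2,3)] le_trans[OF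
        le_trans[OF ord(1,2)] ord(3)])
  moreover have "q ^ B = q ^ C * q ^ (B - C)" using ord by (simp flip: power_add)
  ultimately have "q ^ C * (\<beta> * q ^ (B - C) * ?X + \<gamma> * ?Y) = q ^ C * (\<gamma> * ?Z)"
    by (simp only: distrib_left mult_ac)
  thus ?thesis using q by simp
qed

section \<open>Residue classes modulo 60\<close>

lemma pm_residues_60:
  assumes "R \<subseteq> {0<..<60}"
  shows "pm_residues (int ` R) 60 = {n. n mod 60 \<in> R \<union> (\<lambda>r. 60 - r) ` R}"
proof -
  have "[int n = int r] (mod 60) \<longleftrightarrow> n mod 60 = r" if "r \<in> R" for n r
  proof -
    have "r mod 60 = r" using assms that by auto
    thus ?thesis using cong_int_iff[of n r 60] by (simp add: Cong.cong_def)
  qed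
  moreover have "[int n = - int r] (mod 60) \<longleftrightarrow> n mod 60
      = 60 - r" if "r \<in> R" for n r
  proof -
    have r: "0 < r" "r < 60" using assms that by auto
    have "(- int r) mod 60 = 60 - int r" using r by (simp add: zmod_zminus1_eq_if)
    also have "\<dots> = int (60 - r)" using r by simp
    finally have neg: "(- int r) mod 60 = int (60 - r)" .
    have "int n mod 60 = int (n mod 60)" by (simp add: zmod_int)
    thus ?thesis unfolding Cong.cong_def neg by (simp only: of_nat_eq_iff)
  qed
  moreover have "0 < n" if "n mod 60 \<in> R \<union> (\<lambda>r. 60 - r) ` R" for n
    using assms that by (cases "n = 0") auto
  ultimately show ?thesis by (auto simp: pm_residues_def)
qed

lemma partition_gf_pm_60:
  fixes q :: real
  assumes q: "0 < q" "q < 1" and R: "R \<subseteq> {0<..<30}"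
  shows "(\<lambda>n. num_partitions (pm_residues (int ` R) 60) n * q ^ n)
      sums (1 / (\<Prod>r\<in>R. g60 q r))"
proof -
  have fin: "finite R" using R finite_subset by blast
  have r: "0 < r" "r < 30" if "r \<in> R" for r using R that by auto
  \<comment> \<open>Residues and their negatives lie on different sides of 30, so the product over
    all classes pairs up into factors \<open>g60\<close>.\<close>
  have "R \<inter> (\<lambda>r. 60 - r) ` R = {}"
  proof -
    have "60 - r \<notin> R" if "r \<in> R" for r using r(2)[OF that] r(2)[of "60 - r"] by linarith
    thus ?thesis by blast
  qed
  moreover have inj: "inj_on (\<lambda>r. 60 - r) R"
  proof (rule inj_onI)
    fix a b assume "a \<in> R" "b \<in> R" "60 - a = 60 - b"
    thus "a = b" using r(2)[of a] r(2)[of b] by linarith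
  qed
  ultimately have prod: "(\<Prod>r\<in>R \<union> (\<lambda>r. 60 - r) ` R. qpoch (q ^ r) (q ^ 60))
      = (\<Prod>r\<in>R. g60 q r)"
    using fin by (simp add: prod.union_disjoint prod.reindex g60_def prod.distrib)
  have "r \<in> {0<..<60} \<and> 60 - r \<in> {0<..<60}" if "r \<in> R" for r
    using r[OF that] by auto
  hence sub: "R \<union> (\<lambda>r. 60 - r) ` R \<subseteq> {0<..<60}" by blast
  hence res: "pm_residues (int ` R) 60 = {n. n mod 60 \<in> R \<union> (\<lambda>r. 60 - r) ` R}"
    by (intro pm_residues_60) blast
  show ?thesis
    using partition_gf_residues[OF q sub] unfolding prod res .
qed

text \<open>In the applications \<open>B\<close> is the one product of the three-term relation with
  only positive theta arguments; dividing the relation by it produces the two reciprocals.\<close>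

lemma reciprocal_identity:
  fixes B X Y P Q :: real
  assumes "B \<noteq> 0" "X * P = B" "Y * Q = B" "X = c * Y + d * B"
  shows "1 / P = c * (1 / Q) + d"
proof -
  have nz: "P \<noteq> 0" "Q \<noteq> 0" using assms by auto
  hence "X = B / P" "Y = B / Q" using assms by (auto simp: field_simps)
  hence "B / P = c * (B / Q) + d * B" using assms(4) by simp
  hence "B * (1 / P) = B * (c * (1 / Q) + d)" by (simp add: algebra_simps)
  thus ?thesis by (rule mult_left_cancel[OF assms(1), THEN iffD1])
qed

text \<open>
  The four choices of parameters are, up to sign and modulo 30, the multiples of the exponents 9, 5,
  4, 3 of the first one by the units 1, 7, 11, 13 modulo 60.
\<close>

lemma g60_identity_i:
  assumes q: "0 < q" "q < 1"
  shows "1 / (\<Prod>r\<in>{1, 5, 6, 8, 9, 13, 17, 21, 22, 25, 28, 29}. g60 q r) =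
    q ^ 1 * (1 / (\<Prod>r\<in>{1, 4, 5, 7, 13, 16, 17, 22, 23, 25, 26, 29}. g60 q r)) + q ^ 0"
proof -
  note g60_simps = theta30_g60[OF q] g60_nonzero[OF q] g60_reflect
  show ?thesis
  proof (rule reciprocal_identity)
    \<comment> \<open>Equal signs pair the exponents 9, 4 and 5, 3; the indices are their sums and
      differences.\<close>
    show "theta30 q 1 13 * theta30 q 1 5 * theta30 q 1 8 * theta30 q 1 2 \<noteq> 0"
      by (simp add: g60_simps)
    \<comment> \<open>By \<open>theta30_g60\<close> the factors at 12, 18 and 24 cancel, which
      leaves \<open>g60 q 2\<close> over those at 1, 6, 9, 21 and 29.\<close>
    show "theta30 q (-1) 12 * theta30 q (-1) 6 * theta30 q (-1) 9 * theta30 q (-1) 1 *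
        (\<Prod>r\<in>{1, 5, 6, 8, 9, 13, 17, 21, 22, 25, 28, 29}. g60 q r)
        = theta30 q 1 13 * theta30 q 1 5 * theta30 q 1 8 * theta30 q 1 2"
      by (simp add: g60_simps)
    show "theta30 q (-1) 14 * theta30 q (-1) 4 * theta30 q (-1) 7 * theta30 q (-1) 1 *
        (\<Prod>r\<in>{1, 4, 5, 7, 13, 16, 17, 22, 23, 25, 26, 29}. g60 q r)
        = theta30 q 1 13 * theta30 q 1 5 * theta30 q 1 8 * theta30 q 1 2"
      by (simp add: g60_simps)
    show "theta30 q (-1) 12 * theta30 q (-1) 6 * theta30 q (-1) 9 * theta30 q (-1) 1
        = q ^ 1 * (theta30 q (-1) 14 * theta30 q (-1) 4 * theta30 q (-1) 7 * theta30 q (-1) 1)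
        + q ^ 0 * (theta30 q 1 13 * theta30 q 1 5 * theta30 q 1 8 * theta30 q 1 2)"
      \<comment> \<open>The exponents are listed upwards from \<open>D\<close> to \<open>A\<close>,
        the signs from \<open>\<alpha>\<close> to \<open>\<delta>\<close>.\<close>
      using theta30_three_term[OF q, of 3 4 5 9 "-1" "1" "-1" "1"] by (simp add: mult_ac)
  qed
qed

lemma g60_identity_ii:
  assumes q: "0 < q" "q < 1"
  shows "1 / (\<Prod>r\<in>{1, 2, 5, 7, 8, 11, 19, 23, 25, 26, 28, 29}. g60 q r) =
    q ^ 0 * (1 / (\<Prod>r\<in>{1, 3, 4, 5, 7, 16, 18, 23, 25, 26, 27, 29}. g60 q r)) + q ^ 2"
proof -
  note g60_simps = theta30_g60[OF q] g60_nonzero[OF q] g60_reflect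
  show ?thesis
  proof (rule reciprocal_identity)
    \<comment> \<open>Now equal signs pair 9, 5 and 3, 2, so the divisor is the term carrying
      \<open>q ^ (B - C)\<close>: the pure power is \<open>q ^ 2\<close> and the other quotient is
      not shifted.\<close>
    show "theta30 q 1 14 * theta30 q 1 4 * theta30 q 1 5 * theta30 q 1 1 \<noteq> 0"
      by (simp add: g60_simps)
    show "theta30 q (-1) 11 * theta30 q (-1) 7 * theta30 q (-1) 8 * theta30 q (-1) 2 *
        (\<Prod>r\<in>{1, 2, 5, 7, 8, 11, 19, 23, 25, 26, 28, 29}. g60 q r)
        = theta30 q 1 14 * theta30 q 1 4 * theta30 q 1 5 * theta30 q 1 1"
      by (simp add: g60_simps)
    show "theta30 q (-1) 12 * theta30 q (-1) 6 * theta30 q (-1) 7 * theta30 q (-1) 3 *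
        (\<Prod>r\<in>{1, 3, 4, 5, 7, 16, 18, 23, 25, 26, 27, 29}. g60 q r)
        = theta30 q 1 14 * theta30 q 1 4 * theta30 q 1 5 * theta30 q 1 1"
      by (simp add: g60_simps)
    show "theta30 q (-1) 11 * theta30 q (-1) 7 * theta30 q (-1) 8 * theta30 q (-1) 2
        = q ^ 0 * (theta30 q (-1) 12 * theta30 q (-1) 6 * theta30 q (-1) 7 * theta30 q (-1) 3)
        + q ^ 2 * (theta30 q 1 14 * theta30 q 1 4 * theta30 q 1 5 * theta30 q 1 1)"
      using theta30_three_term[OF q, of 2 3 5 9 "1" "1" "-1" "-1"] by (simp add: mult_ac)
  qed
qed

lemma g60_identity_iii:
  assumes q: "0 < q" "q < 1"
  shows "1 / (\<Prod>r\<in>{2, 4, 5, 7, 11, 13, 14, 16, 17, 19, 23, 25}. g60 q r) =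
    q ^ 0 * (1 / (\<Prod>r\<in>{2, 5, 6, 7, 8, 9, 11, 19, 21, 23, 25, 28}. g60 q r)) + q ^ 4"
proof -
  note g60_simps = theta30_g60[OF q] g60_nonzero[OF q] g60_reflect
  show ?thesis
  proof (rule reciprocal_identity)
    \<comment> \<open>Equal signs pair 14, 9 and 5, 3, so again the factor
      \<open>q ^ (9 - 5)\<close> falls on the divisor.\<close>
    show "theta30 q 1 23 * theta30 q 1 5 * theta30 q 1 8 * theta30 q 1 2 \<noteq> 0"
      by (simp add: g60_simps)
    show "theta30 q (-1) 17 * theta30 q (-1) 11 * theta30 q (-1) 14 * theta30 q (-1) 4 *
        (\<Prod>r\<in>{2, 4, 5, 7, 11, 13, 14, 16, 17, 19, 23, 25}. g60 q r)
        = theta30 q 1 23 * theta30 q 1 5 * theta30 q 1 8 * theta30 q 1 2"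
      by (simp add: g60_simps)
    show "theta30 q (-1) 19 * theta30 q (-1) 9 * theta30 q (-1) 12 * theta30 q (-1) 6 *
        (\<Prod>r\<in>{2, 5, 6, 7, 8, 9, 11, 19, 21, 23, 25, 28}. g60 q r)
        = theta30 q 1 23 * theta30 q 1 5 * theta30 q 1 8 * theta30 q 1 2"
      by (simp add: g60_simps)
    show "theta30 q (-1) 17 * theta30 q (-1) 11 * theta30 q (-1) 14 * theta30 q (-1) 4
        = q ^ 0 * (theta30 q (-1) 19 * theta30 q (-1) 9 * theta30 q (-1) 12 * theta30 q (-1) 6)
        + q ^ 4 * (theta30 q 1 23 * theta30 q 1 5 * theta30 q 1 8 * theta30 q 1 2)"
      using theta30_three_term[OF q, of 3 5 9 14 "-1" "-1" "1" "1"] by (simp add: mult_ac)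
  qed
qed

lemma g60_identity_iv:
  assumes q: "0 < q" "q < 1"
  shows "1 / (\<Prod>r\<in>{3, 4, 5, 11, 13, 14, 16, 17, 18, 19, 25, 27}. g60 q r) =
    q ^ 3 * (1 / (\<Prod>r\<in>{1, 5, 8, 11, 13, 14, 17, 19, 22, 25, 28, 29}. g60 q r)) + q ^ 0"
proof -
  note g60_simps = theta30_g60[OF q] g60_nonzero[OF q] g60_reflect
  show ?thesis
  proof (rule reciprocal_identity)
    \<comment> \<open>Equal signs pair 9, 5 and 8, 3, so the factor \<open>q ^ (8 - 5)\<close> stays
      with the second quotient and the pure power is 1.\<close>
    show "theta30 q 1 14 * theta30 q 1 4 * theta30 q 1 11 * theta30 q 1 5 \<noteq> 0"
      by (simp add: g60_simps)
    show "theta30 q (-1) 12 * theta30 q (-1) 6 * theta30 q (-1) 13 * theta30 q (-1) 3 *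
        (\<Prod>r\<in>{3, 4, 5, 11, 13, 14, 16, 17, 18, 19, 25, 27}. g60 q r)
        = theta30 q 1 14 * theta30 q 1 4 * theta30 q 1 11 * theta30 q 1 5"
      by (simp add: g60_simps)
    show "theta30 q (-1) 17 * theta30 q (-1) 1 * theta30 q (-1) 8 * theta30 q (-1) 2 *
        (\<Prod>r\<in>{1, 5, 8, 11, 13, 14, 17, 19, 22, 25, 28, 29}. g60 q r)
        = theta30 q 1 14 * theta30 q 1 4 * theta30 q 1 11 * theta30 q 1 5"
      by (simp add: g60_simps)
    show "theta30 q (-1) 12 * theta30 q (-1) 6 * theta30 q (-1) 13 * theta30 q (-1) 3
        = q ^ 3 * (theta30 q (-1) 17 * theta30 q (-1) 1 * theta30 q (-1) 8 * theta30 q (-1) 2)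
        + q ^ 0 * (theta30 q 1 14 * theta30 q 1 4 * theta30 q 1 11 * theta30 q 1 5)"
      using theta30_three_term[OF q, of 3 5 8 9 "1" "-1" "1" "-1"] by (simp add: mult_ac)
  qed
qed

lemma partition_identity_60:
  assumes R: "R \<subseteq> {0<..<30}" "R' \<subseteq> {0<..<30}"
    and id: "\<And>q::real. 0 < q \<Longrightarrow> q < 1 \<Longrightarrow>
      1 / (\<Prod>r\<in>R. g60 q r) = q ^ e * (1 / (\<Prod>r\<in>R'. g60 q r)) + q ^ d"
  shows "num_partitions (pm_residues (int ` R) 60) n =
    (if e \<le> n then num_partitions (pm_residues (int ` R') 60) (n - e) else 0) + (if n
        = d then 1 else 0)"
  using partition_gf_pm_60[OF _ _ R(1)] partition_gf_pm_60[OF _ _ R(2)] id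
  by (rule shifted_partition_identity)

theorem theorem12p2:
  shows
    "(\<forall>S T. S = pm_residues {1, 5, 6, 8, 9, 13, 17, 21, 22, 25, 28, 29} 60 \<longrightarrow>
        T = pm_residues {1, 4, 5, 7, 13, 16, 17, 22, 23, 25, 26, 29} 60 \<longrightarrow>
        (\<forall>n\<ge>1. num_partitions S n = num_partitions T (n - 1))) \<and>
     (\<forall>S T. S = pm_residues {1, 2, 5, 7, 8, 11, 19, 23, 25, 26, 28, 29} 60 \<longrightarrow>
        T = pm_residues {1, 3, 4, 5, 7, 16, 18, 23, 25, 26, 27, 29} 60 \<longrightarrow>
        (\<forall>n. n \<noteq> 2 \<longrightarrow> num_partitions S n = num_partitions T n)) \<and>
     (\<forall>S T. S = pm_residues {2, 4, 5, 7, 11, 13, 14, 16, 17, 19, 23, 25} 60 \<longrightarrow>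
        T = pm_residues {2, 5, 6, 7, 8, 9, 11, 19, 21, 23, 25, 28} 60 \<longrightarrow>
        (\<forall>n. n \<noteq> 4 \<longrightarrow> num_partitions S n = num_partitions T n)) \<and>
     (\<forall>S T. S = pm_residues {3, 4, 5, 11, 13, 14, 16, 17, 18, 19, 25, 27} 60 \<longrightarrow>
        T = pm_residues {1, 5, 8, 11, 13, 14, 17, 19, 22, 25, 28, 29} 60 \<longrightarrow>
        (\<forall>n\<ge>3. num_partitions S n = num_partitions T (n - 3)))"
proof (intro conjI allI impI)
  fix S T and n :: nat
  assume "S = pm_residues {1, 5, 6, 8, 9, 13, 17, 21, 22, 25, 28, 29} 60" "T = pm_residues {1, 4, 5, 7, 13, 16, 17, 22, 23, 25, 26, 29} 60" "n \<ge> 1"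
  thus "num_partitions S n = num_partitions T (n - 1)"
    \<comment> \<open>Here \<open>e = 1\<close>, and the exceptional coefficient at
      \<open>d = 0\<close> lies outside the range of \<open>n\<close>.\<close>
    using partition_identity_60[OF _ _ g60_identity_i, of n] by simp
next
  fix S T and n :: nat
  assume "S = pm_residues {1, 2, 5, 7, 8, 11, 19, 23, 25, 26, 28, 29} 60" "T = pm_residues {1, 3, 4, 5, 7, 16, 18, 23, 25, 26, 27, 29} 60" "n \<noteq> 2"
  thus "num_partitions S n = num_partitions T n"
    \<comment> \<open>Here \<open>e = 0\<close>, and \<open>d = 2\<close> is exactly the excluded
      value, where the counts differ by one.\<close>
    using partition_identity_60[OF _ _ g60_identity_ii, of n] by simp
next
  fix S T and n :: nat
  assume "S = pm_residues {2, 4, 5, 7, 11, 13, 14, 16, 17, 19, 23, 25} 60" "T = pm_residues {2, 5, 6, 7, 8, 9, 11, 19, 21, 23, 25, 28} 60" "n \<noteq> 4"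
  thus "num_partitions S n = num_partitions T n"
    using partition_identity_60[OF _ _ g60_identity_iii, of n] by simp
next
  fix S T and n :: nat
  assume "S = pm_residues {3, 4, 5, 11, 13, 14, 16, 17, 18, 19, 25, 27} 60" "T = pm_residues {1, 5, 8, 11, 13, 14, 17, 19, 22, 25, 28, 29} 60" "n \<ge> 3"
  thus "num_partitions S n = num_partitions T (n - 3)"
    using partition_identity_60[OF _ _ g60_identity_iv, of n] by simp
qed

end
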